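(* Let $X$ be a non-negative random variable with absolutely continuous distribution function $F$ and finite mean. Then the Gini mean difference of $X$ is expressed through probability weighted moments as $$GMD=2\mathcal{M}_{1,1,0}-2\mathcal{M}_{1,0,1}.$$
   Context: The Gini mean difference is $GMD=E|X_1-X_2|$, where $X_1,X_2$ are independent with distribution function $F$. For real $p,r,s$ for which the expectation exists, the probability weighted moment of $X$ is $\mathcal{M}_{p,r,s}=E\{X^pF^r(X)(1-F(X))^s\}$. *)

theory Defs
  imports "HOL-Probability.Probability"
begin

text \<open>
  The usual epsilon-delta absolute continuity of a function on the whole real line. (The library's
  \<open>absolutely_continuous\<close> is the relation between measures.) For a distribution function, which
  is monotone and bounded, absolute continuity on every compact interval amounts to the same.
\<close>

definition abs_continuous_fun :: "(real \<Rightarrow> real) \<Rightarrow> bool" where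
  "abs_continuous_fun F \<longleftrightarrow>
     (\<forall>\<epsilon>>0. \<exists>\<delta>>0. \<forall>(n::nat) (a::nat \<Rightarrow> real) (b::nat \<Rightarrow> real).
        (\<forall>i<n. a i \<le> b i) \<longrightarrow>
        disjoint_family_on (\<lambda>i. {a i<..<b i}) {..<n} \<longrightarrow>
        (\<Sum>i<n. b i - a i) < \<delta> \<longrightarrow>
        (\<Sum>i<n. \<bar>F (b i) - F (a i)\<bar>) < \<epsilon>)"

definition dist_fun :: "'a measure \<Rightarrow> ('a \<Rightarrow> real) \<Rightarrow> real \<Rightarrow> real" where
  "dist_fun M X = cdf (distr M borel X)"

text \<open>
  Powers with a real exponent. \<open>powr\<close> alone would give \<open>0 powr 0 = 0\<close> and would be wrong for a
  negative base with an integer exponent.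
\<close>

definition real_pow :: "real \<Rightarrow> real \<Rightarrow> real" where
  "real_pow x p = (if p \<in> \<int> then x powi \<lfloor>p\<rfloor> else x powr p)"

definition pwm :: "'a measure \<Rightarrow> ('a \<Rightarrow> real) \<Rightarrow> real \<Rightarrow> real \<Rightarrow> real \<Rightarrow> real" where
  "pwm M X p r s =
     prob_space.expectation M
       (\<lambda>\<omega>. real_pow (X \<omega>) p * real_pow (dist_fun M X (X \<omega>)) r
             * real_pow (1 - dist_fun M X (X \<omega>)) s)"

lemma real_pow_0 [simp]: "real_pow x 0 = 1"
  by (simp add: real_pow_def)

lemma real_pow_1 [simp]: "real_pow x 1 = x"
  by (simp add: real_pow_def)

text \<open>
  Bochner integrals of non-integrable functions are 0 by convention. The next three lemmas show
  that a finite mean rules this out for the expectations that matter here.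
\<close>

lemma dist_fun_bounds:
  assumes "prob_space M" "X \<in> borel_measurable M"
  shows "0 \<le> dist_fun M X x" "dist_fun M X x \<le> 1"
    and "(\<lambda>\<omega>. dist_fun M X (X \<omega>)) \<in> borel_measurable M"
proof -
  interpret prob_space M by fact
  interpret D: real_distribution "distr M borel X"
    using assms by (intro real_distribution_distr) simp
  show "0 \<le> dist_fun M X x" "dist_fun M X x \<le> 1"
    by (simp_all add: dist_fun_def D.cdf_nonneg D.cdf_bounded_prob)
  have "mono (cdf (distr M borel X))"
    by (intro monoI D.cdf_nondecreasing)
  then show "(\<lambda>\<omega>. dist_fun M X (X \<omega>)) \<in> borel_measurable M"
    unfolding dist_fun_def
    by (rule measurable_compose[OF assms(2) borel_measurable_mono])
qed

lemma pwm_integrable: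
  assumes M: "prob_space M" and X: "integrable M X"
  shows "integrable M (\<lambda>\<omega>. real_pow (X \<omega>) 1 * real_pow (dist_fun M X (X \<omega>)) 1
                            * real_pow (1 - dist_fun M X (X \<omega>)) 0)"
    and "integrable M (\<lambda>\<omega>. real_pow (X \<omega>) 1 * real_pow (dist_fun M X (X \<omega>)) 0
                            * real_pow (1 - dist_fun M X (X \<omega>)) 1)"
proof -
  note b = dist_fun_bounds[OF M borel_measurable_integrable[OF X]]
  note [measurable] = b(3) borel_measurable_integrable[OF X]
  have "integrable M (\<lambda>\<omega>. X \<omega> * dist_fun M X (X \<omega>))"
  proof (rule Bochner_Integration.integrable_bound[OF X])
    show "AE \<omega> in M. norm (X \<omega> * dist_fun M X (X \<omega>)) \<le> norm (X \<omega>)"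
    proof (rule AE_I2)
      fix \<omega>
      have "\<bar>dist_fun M X (X \<omega>)\<bar> \<le> 1" using b(1,2)[of "X \<omega>"] by simp
      then show "norm (X \<omega> * dist_fun M X (X \<omega>)) \<le> norm (X \<omega>)"
        using mult_left_mono[of "\<bar>dist_fun M X (X \<omega>)\<bar>" 1 "\<bar>X \<omega>\<bar>"] by (simp add: abs_mult)
    qed
  qed measurable
  moreover have "integrable M (\<lambda>\<omega>. X \<omega> * (1 - dist_fun M X (X \<omega>)))"
  proof (rule Bochner_Integration.integrable_bound[OF X])
    show "AE \<omega> in M. norm (X \<omega> * (1 - dist_fun M X (X \<omega>))) \<le> norm (X \<omega>)"
    proof (rule AE_I2)
      fix \<omega>
      have "\<bar>(1 - dist_fun M X (X \<omega>))\<bar> \<le> 1" using b(1,2)[of "X \<omega>"] by simp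
      then show "norm (X \<omega> * (1 - dist_fun M X (X \<omega>))) \<le> norm (X \<omega>)"
        using mult_left_mono[of "\<bar>(1 - dist_fun M X (X \<omega>))\<bar>" 1 "\<bar>X \<omega>\<bar>"] by (simp add: abs_mult)
    qed
  qed measurable
  ultimately show
    "integrable M (\<lambda>\<omega>. real_pow (X \<omega>) 1 * real_pow (dist_fun M X (X \<omega>)) 1
                        * real_pow (1 - dist_fun M X (X \<omega>)) 0)"
    "integrable M (\<lambda>\<omega>. real_pow (X \<omega>) 1 * real_pow (dist_fun M X (X \<omega>)) 0
                        * real_pow (1 - dist_fun M X (X \<omega>)) 1)"
    by simp_all
qed

lemma gini_integrable:
  assumes M: "prob_space M" and X: "integrable M X"
    and N: "prob_space N" "X1 \<in> borel_measurable N" "X2 \<in> borel_measurable N"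
    and eq: "dist_fun N X1 = dist_fun M X" "dist_fun N X2 = dist_fun M X"
  shows "integrable N (\<lambda>\<omega>. \<bar>X1 \<omega> - X2 \<omega>\<bar>)"
proof -
  have "integrable N Y"
    if Y: "Y \<in> borel_measurable N" "dist_fun N Y = dist_fun M X" for Y
  proof -
    have Xm: "X \<in> borel_measurable M" using X by simp
    have "distr N borel Y = distr M borel X"
    proof (rule cdf_unique)
      show "real_distribution (distr N borel Y)"
        by (rule prob_space.real_distribution_distr[OF N(1) Y(1)])
      show "real_distribution (distr M borel X)"
        by (rule prob_space.real_distribution_distr[OF M Xm])
      show "cdf (distr N borel Y) = cdf (distr M borel X)"
        using Y(2) by (simp only: dist_fun_def)
    qed
    moreover have "integrable (distr M borel X) (\<lambda>x. x)"
      using X by (subst integrable_distr_eq[OF Xm]) simp_all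
    ultimately have "integrable (distr N borel Y) (\<lambda>x. x)" by simp
    then show ?thesis
      by (subst (asm) integrable_distr_eq[OF Y(1)]) simp_all
  qed
  from this[OF N(2) eq(1)] this[OF N(3) eq(2)] show ?thesis
    by (intro integrable_abs Bochner_Integration.integrable_diff)
qed

end

theory Submission
  imports Defs
begin

text \<open>
  Write \<open>|x - y| = x * sgn (x - y) + y * sgn (y - x)\<close>. For independent variables with common law
  \<open>D\<close> the two terms have the same expectation, so \<open>GMD\<close> is twice the expectation of
  \<open>X * g X\<close> with \<open>g x = P (Y < x) - P (Y > x)\<close>. As \<open>D\<close> has no atoms,
  \<open>g x = F x - (1 - F x)\<close>.
\<close>

text \<open>A family of one interval suffices: for it, the condition on sums is the epsilon-delta
  condition at \<open>x\<close>.\<close>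

lemma abs_continuous_fun_isCont:
  assumes "abs_continuous_fun F"
  shows "isCont F x"
  unfolding continuous_at_eps_delta
proof (intro allI impI)
  fix e :: real assume "e > 0"
  with assms obtain d where d: "d > 0"
    and *: "\<And>(n::nat) a b. \<forall>i<n. a i \<le> b i \<Longrightarrow> disjoint_family_on (\<lambda>i. {a i<..<b i}) {..<n} \<Longrightarrow>
        (\<Sum>i<n. b i - a i) < d \<Longrightarrow> (\<Sum>i<n. \<bar>F (b i) - F (a i)\<bar>) < e"
    unfolding abs_continuous_fun_def by meson
  \<comment> \<open>The end points are sorted by \<open>min\<close> and \<open>max\<close>, since
    \<open>y\<close> may lie on either side of \<open>x\<close>.\<close>
  have "\<bar>F y - F x\<bar> < e" if "\<bar>y - x\<bar> < d" for y
    using *[of 1 "\<lambda>_. min x y" "\<lambda>_. max x y"] that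
    by (cases "x \<le> y") (auto simp: disjoint_family_on_def min_def max_def abs_minus_commute)
  with d show "\<exists>d>0. \<forall>x'. dist x' x < d \<longrightarrow> dist (F x') (F x) < e"
    by (auto simp: dist_real_def)
qed

text \<open>The integral is P (Y < x) - P (Y > x) for Y with law \<open>M\<close>. Continuity of the
  cdf at \<open>x\<close> excludes an atom there, so P (Y < x) is \<open>cdf M x\<close>.\<close>

lemma (in real_distribution) integral_sgn_diff:
  assumes "isCont (cdf M) x"
  shows "(\<integral>y. sgn (x - y) \<partial>M) = 2 * cdf M x - 1"
proof -
  have "measure M {x} = 0"
    using assms isCont_cdf by simp
  then have null: "AE y in M. y \<noteq> x"
    by (subst AE_iff_null) (auto simp: null_sets_def emeasure_eq_measure)
  have "(\<integral>y. sgn (x - y) \<partial>M) = (\<integral>y. 2 * indicator {..x} y - 1 \<partial>M)"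
  proof (rule integral_cong_AE)
    \<comment> \<open>At \<open>y = x\<close> the left side is 0 and the right side is 1; elsewhere
      they agree.\<close>
    show "AE y in M. sgn (x - y) = 2 * indicator {..x} y - 1"
      using null by eventually_elim (auto simp: indicator_def sgn_if)
  qed simp_all
  also have "\<dots> = 2 * cdf M x - 1"
    using prob_space
    by (subst Bochner_Integration.integral_diff)
      (auto simp: cdf_def emeasure_eq_measure intro!: integrable_mult_right integrable_real_indicator)
  finally show ?thesis .
qed

lemma (in real_distribution) integral_abs_diff:
  assumes int: "integrable M (\<lambda>x. x)" and cont: "\<And>x. isCont (cdf M) x"
  shows "(\<integral>z. \<bar>fst z - snd z\<bar> \<partial>(M \<Otimes>\<^sub>M M)) = 2 * (\<integral>x. x * (2 * cdf M x - 1) \<partial>M)"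
proof -
  interpret P: pair_prob_space M M ..
  let ?h = "\<lambda>(x, y). x * sgn (x - y)"
  \<comment> \<open>The first projection maps the product measure to \<open>M\<close>, so the finite
    mean carries over; as \<open>sgn\<close> is bounded by 1, \<open>fst\<close> then dominates
    \<open>?h\<close>.\<close>
  have fst: "integrable (M \<Otimes>\<^sub>M M) (\<lambda>z. fst z)"
    using int by (intro integrable_distr[of fst _ M]) (simp_all add: distr_pair_fst)
  have h: "integrable (M \<Otimes>\<^sub>M M) ?h"
    by (rule Bochner_Integration.integrable_bound[OF fst])
      (auto simp: case_prod_beta abs_mult sgn_if)
  have h': "integrable (M \<Otimes>\<^sub>M M) (\<lambda>(x, y). ?h (y, x))"
    using P.integrable_product_swap[OF h] .
  have "(\<integral>z. \<bar>fst z - snd z\<bar> \<partial>(M \<Otimes>\<^sub>M M)) = (\<integral>z. ?h z + (\<lambda>(x, y). ?h (y, x)) z \<partial>(M \<Otimes>\<^sub>M M))"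
    by (intro Bochner_Integration.integral_cong) (auto simp: sgn_if abs_if)
  also have "\<dots> = (\<integral>z. ?h z \<partial>(M \<Otimes>\<^sub>M M)) + (\<integral>z. (\<lambda>(x, y). ?h (y, x)) z \<partial>(M \<Otimes>\<^sub>M M))"
    by (rule Bochner_Integration.integral_add[OF h h'])
  \<comment> \<open>Swapping the coordinates preserves \<open>M \<Otimes>\<^sub>M M\<close>, so both
    summands have the same integral.\<close>
  also have "\<dots> = 2 * (\<integral>z. ?h z \<partial>(M \<Otimes>\<^sub>M M))"
    using P.integral_product_swap[of ?h] h by simp
  also have "(\<integral>z. ?h z \<partial>(M \<Otimes>\<^sub>M M)) = (\<integral>x. (\<integral>y. x * sgn (x - y) \<partial>M) \<partial>M)"
    using P.integral_fst'[OF h] by simp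
  also have "\<dots> = (\<integral>x. x * (2 * cdf M x - 1) \<partial>M)"
    by (simp add: integral_sgn_diff[OF cont])
  finally show ?thesis .
qed

theorem mainTheorem7:
  fixes M :: "'a measure" and X :: "'a \<Rightarrow> real"
    and N :: "'b measure" and X1 X2 :: "'b \<Rightarrow> real"
  assumes "prob_space M"
    and "X \<in> borel_measurable M"
    and "AE \<omega> in M. 0 \<le> X \<omega>"
    and "abs_continuous_fun (dist_fun M X)"
    and "integrable M X"
    and "prob_space N"
    and "prob_space.indep_var N borel X1 borel X2"
    and "dist_fun N X1 = dist_fun M X"
    and "dist_fun N X2 = dist_fun M X"
  shows "prob_space.expectation N (\<lambda>\<omega>. \<bar>X1 \<omega> - X2 \<omega>\<bar>) = 2 * pwm M X 1 1 0 - 2 * pwm M X 1 0 1"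
proof -
  interpret N: prob_space N by fact
  note [measurable] = assms(2)
  have [measurable]: "X1 \<in> borel_measurable N" "X2 \<in> borel_measurable N"
    using N.indep_var_rv1[OF assms(7)] N.indep_var_rv2[OF assms(7)] by auto
  let ?D = "distr M borel X"
  interpret D: real_distribution ?D
    using assms(1,2) by (rule prob_space.real_distribution_distr)
  \<comment> \<open>A law on the reals is determined by its cdf. Together with independence this
    makes the joint law of \<open>X1\<close> and \<open>X2\<close> the product of \<open>?D\<close>
    with itself.\<close>
  have law: "distr N borel Y = ?D"
    if "Y \<in> borel_measurable N" "dist_fun N Y = dist_fun M X" for Y
    using that N.real_distribution_distr D.real_distribution_axioms
    by (intro cdf_unique) (auto simp: dist_fun_def)
  have joint: "distr N (borel \<Otimes>\<^sub>M borel) (\<lambda>\<omega>. (X1 \<omega>, X2 \<omega>)) = ?D \<Otimes>\<^sub>M ?D"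
    using N.indep_var_distribution_eq[of borel X1 borel X2] assms(7) law assms(8,9) by simp
  have cont: "isCont (cdf ?D) x" for x
    using abs_continuous_fun_isCont[OF assms(4)] by (simp add: dist_fun_def)
  have mean: "integrable ?D (\<lambda>x. x)"
    using assms(5) by (simp add: integrable_distr_eq)
  have [measurable]: "cdf ?D \<in> borel_measurable borel"
    by (intro borel_measurable_mono monoI D.cdf_nondecreasing)
  have "(\<integral>\<omega>. \<bar>X1 \<omega> - X2 \<omega>\<bar> \<partial>N)
      = (\<integral>z. \<bar>fst z - snd z\<bar> \<partial>distr N (borel \<Otimes>\<^sub>M borel) (\<lambda>\<omega>. (X1 \<omega>, X2 \<omega>)))"
    by (subst integral_distr) simp_all
  also have "\<dots> = 2 * (\<integral>x. x * (2 * cdf ?D x - 1) \<partial>?D)"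
    unfolding joint by (rule D.integral_abs_diff[OF mean cont])
  also have "(\<integral>x. x * (2 * cdf ?D x - 1) \<partial>?D) = (\<integral>\<omega>. X \<omega> * (2 * dist_fun M X (X \<omega>) - 1) \<partial>M)"
    by (subst integral_distr) (simp_all add: dist_fun_def)
  \<comment> \<open>With F the distribution function, 2 F - 1 = F - (1 - F); integrability of both
    moments allows their difference to be taken under one integral.\<close>
  also have "\<dots> = pwm M X 1 1 0 - pwm M X 1 0 1"
    unfolding pwm_def Bochner_Integration.integral_diff[OF pwm_integrable[OF assms(1,5)], symmetric]
    by (simp add: algebra_simps)
  finally show ?thesis by simp
qed

end
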